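(* If $W_1,W_2,\dots$ is a sequence of graphons converging almost everywhere to a graphon $W$, then $\lim_{n\to\infty}\overline{\mathrm{cd}}(W_n)=\overline{\mathrm{cd}}(W)$ and $\lim_{n\to\infty}\mathrm{cd}(W_n)=\mathrm{cd}(W)$.
   Context: A graphon is a symmetric measurable function $W:[0,1]^2\to[0,1]$. For points $x,y,z,w\in\mathbb R^2$ let $I(x,y,z,w)=1$ if $\mathrm{conv}\{x,y\}\cap\mathrm{conv}\{z,w\}\ne\emptyset$ and $0$ otherwise. Let $\mathcal F$ be the family of bounded measurable functions $f:[0,1]\to\mathbb R^2$, and $I_f(x_1,\dots,x_4)=I(f(x_1),\dots,f(x_4))$. Define $\overline{\mathrm{cd}}(W,f)=\frac18\int_{[0,1]^4}W(x_1,x_2)W(x_3,x_4)I_f(x_1,x_2,x_3,x_4)\prod dx_i$ and the rectilinear crossing density $\overline{\mathrm{cd}}(W)=\inf_{f\in\mathcal F}\overline{\mathrm{cd}}(W,f)$. Let $\mathcal C$ be the set of curves $c:[0,1]\to\mathbb R^2$ that are simple or constant. A simple graphon drawing is a map $\mathcal D:[0,1]^2\to\mathcal C$ such that: (1) $\mathcal D(x,y)(t)=\mathcal D(y,x)(1-t)$; (2) the image of $\mathcal D(x,x)$ is a single point $\mathcal D(x)$; (3) $\mathcal D(x,y)(0)=\mathcal D(x)$; (4) if the images of $\mathcal D(x_1,y_1)$ and $\mathcal D(x_2,y_2)$ are not equal as sets, they have at most one common point. Let $I_{\mathcal D}(x,y,z,w)=1$ if $\mathcal D(x,y)$ and $\mathcal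 D(z,w)$ share a point and $0$ otherwise, and $\mathcal D_{\mathcal W}$ the set of simple graphon drawings with $I_{\mathcal D}$ measurable. Define $\mathrm{cd}(W,\mathcal D)=\frac18\int_{[0,1]^4}W(x_1,x_2)W(x_3,x_4)I_{\mathcal D}(x_1,x_2,x_3,x_4)\prod dx_i$ and the crossing density $\mathrm{cd}(W)=\inf_{\mathcal D\in\mathcal D_{\mathcal W}}\mathrm{cd}(W,\mathcal D)$. *)

theory Defs
  imports "HOL-Analysis.Analysis"
begin

text \<open>
  Measurability and integration refer to Lebesgue measure on the unit interval, square and
  four-dimensional cube. Functions with domain \<open>[0,1]\<close> or \<open>[0,1]\<^sup>2\<close> are total functions whose
  values outside that domain are never used.
\<close>

abbreviation unit_square :: "(real \<times> real) set" where
  "unit_square \<equiv> {0..1} \<times> {0..1}"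

abbreviation unit_cube4 :: "(real \<times> real \<times> real \<times> real) set" where
  "unit_cube4 \<equiv> {0..1} \<times> {0..1} \<times> {0..1} \<times> {0..1}"

definition graphon :: "(real \<times> real \<Rightarrow> real) \<Rightarrow> bool" where
  "graphon W \<longleftrightarrow>
     W \<in> borel_measurable (lebesgue_on unit_square) \<and>
     (\<forall>x\<in>{0..1}. \<forall>y\<in>{0..1}. W (x, y) = W (y, x)) \<and>
     (\<forall>x\<in>{0..1}. \<forall>y\<in>{0..1}. 0 \<le> W (x, y) \<and> W (x, y) \<le> 1)"

subsection \<open>Rectilinear crossing density\<close>

definition segments_meet :: "real^2 \<Rightarrow> real^2 \<Rightarrow> real^2 \<Rightarrow> real^2 \<Rightarrow> real" where
  "segments_meet x y z w =
     (if convex hull {x, y} \<inter> convex hull {z, w} \<noteq> {} then 1 else 0)"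

definition placements :: "(real \<Rightarrow> real^2) set" where
  "placements = {f. f \<in> borel_measurable (lebesgue_on {0..1}) \<and> bounded (f ` {0..1})}"

definition rect_crossing_density_of :: "(real \<times> real \<Rightarrow> real) \<Rightarrow> (real \<Rightarrow> real^2) \<Rightarrow> real" where
  "rect_crossing_density_of W f = 1 / 8 *
     integral\<^sup>L (lebesgue_on unit_cube4)
       (\<lambda>(x1, x2, x3, x4).
          W (x1, x2) * W (x3, x4) * segments_meet (f x1) (f x2) (f x3) (f x4))"

definition rect_crossing_density :: "(real \<times> real \<Rightarrow> real) \<Rightarrow> real" where
  "rect_crossing_density W = (INF f\<in>placements. rect_crossing_density_of W f)"

subsection \<open>Crossing density\<close>

text \<open>
  A simple curve is an injective one, hence \<^const>\<open>arc\<close> and not \<^const>\<open>simple_path\<close>: the latter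
  also admits closed curves.
\<close>

definition simple_or_constant_curves :: "(real \<Rightarrow> real^2) set" where
  "simple_or_constant_curves =
     {c. arc c \<or> (\<exists>p. \<forall>t\<in>{0..1}. c t = p)}"

text \<open>The point \<open>\<D>(x)\<close>; meaningful when the image of \<open>\<D>(x,x)\<close> is a singleton.\<close>

definition drawing_vertex :: "(real \<Rightarrow> real \<Rightarrow> real \<Rightarrow> real^2) \<Rightarrow> real \<Rightarrow> real^2" where
  "drawing_vertex D x = the_elem (path_image (D x x))"

definition simple_graphon_drawing :: "(real \<Rightarrow> real \<Rightarrow> real \<Rightarrow> real^2) \<Rightarrow> bool" where
  "simple_graphon_drawing D \<longleftrightarrow>
     (\<forall>x\<in>{0..1}. \<forall>y\<in>{0..1}. D x y \<in> simple_or_constant_curves) \<and>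
     (\<forall>x\<in>{0..1}. \<forall>y\<in>{0..1}. \<forall>t\<in>{0..1}. D x y t = D y x (1 - t)) \<and>
     (\<forall>x\<in>{0..1}. \<exists>p. path_image (D x x) = {p}) \<and>
     (\<forall>x\<in>{0..1}. \<forall>y\<in>{0..1}. D x y 0 = drawing_vertex D x) \<and>
     (\<forall>x1\<in>{0..1}. \<forall>y1\<in>{0..1}. \<forall>x2\<in>{0..1}. \<forall>y2\<in>{0..1}.
        path_image (D x1 y1) \<noteq> path_image (D x2 y2) \<longrightarrow>
        (\<exists>p. path_image (D x1 y1) \<inter> path_image (D x2 y2) \<subseteq> {p}))"

definition curves_meet ::
    "(real \<Rightarrow> real \<Rightarrow> real \<Rightarrow> real^2) \<Rightarrow> real \<Rightarrow> real \<Rightarrow> real \<Rightarrow> real \<Rightarrow> real" where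
  "curves_meet D x y z w =
     (if path_image (D x y) \<inter> path_image (D z w) \<noteq> {} then 1 else 0)"

definition measurable_drawings :: "(real \<Rightarrow> real \<Rightarrow> real \<Rightarrow> real^2) set" where
  "measurable_drawings =
     {D. simple_graphon_drawing D \<and>
         (\<lambda>(x1, x2, x3, x4). curves_meet D x1 x2 x3 x4)
           \<in> borel_measurable (lebesgue_on unit_cube4)}"

definition crossing_density_of ::
    "(real \<times> real \<Rightarrow> real) \<Rightarrow> (real \<Rightarrow> real \<Rightarrow> real \<Rightarrow> real^2) \<Rightarrow> real" where
  "crossing_density_of W D = 1 / 8 *
     integral\<^sup>L (lebesgue_on unit_cube4)
       (\<lambda>(x1, x2, x3, x4).
          W (x1, x2) * W (x3, x4) * curves_meet D x1 x2 x3 x4)"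

definition crossing_density :: "(real \<times> real \<Rightarrow> real) \<Rightarrow> real" where
  "crossing_density W = (INF D\<in>measurable_drawings. crossing_density_of W D)"

end

theory Submission
  imports Defs
begin

text \<open>
  Both densities are infima over a family of kernels \<open>k : [0,1]\<^sup>4 \<rightarrow> [0,1]\<close> of
  \<open>F\<^sub>V(k) = 1/8 \<integral> V(x\<^sub>1,x\<^sub>2) V(x\<^sub>3,x\<^sub>4) k\<close>. For graphons \<open>V\<close>, \<open>W\<close> the difference
  \<open>|F\<^sub>V(k) - F\<^sub>W(k)|\<close> is at most
  \<open>1/8 \<integral> |V(x\<^sub>1,x\<^sub>2) V(x\<^sub>3,x\<^sub>4) - W(x\<^sub>1,x\<^sub>2) W(x\<^sub>3,x\<^sub>4)|\<close>, which does not depend on \<open>k\<close>. So the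
  infima differ by no more than that, and the bound tends to 0 by dominated convergence.
\<close>

subsection \<open>Nonsingular maps\<close>

text \<open>
  Lebesgue measurable functions compose only with maps that pull null sets back to null sets.
\<close>

definition nonsingular :: "('a::euclidean_space \<Rightarrow> 'b::euclidean_space) \<Rightarrow> bool" where
  "nonsingular f \<longleftrightarrow> f \<in> borel_measurable borel \<and> (\<forall>N. negligible N \<longrightarrow> negligible (f -` N))"

lemma nonsingular_comp:
  assumes "nonsingular f" "nonsingular g"
  shows "nonsingular (g \<circ> f)"
  using assms unfolding nonsingular_def
  by (auto simp: vimage_comp[symmetric] intro: measurable_comp)

text \<open>\<open>lebesgue\<close> on the product is the completion of a product measure, so the
  null set is first enlarged to a Borel null set, where the product rule for \<open>lborel\<close>
  applies.\<close>

lemma negligible_Times_UNIV: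
  fixes N :: "'a::euclidean_space set"
  assumes "negligible N"
  shows "negligible (N \<times> (UNIV :: 'b::euclidean_space set))"
    and "negligible ((UNIV :: 'b::euclidean_space set) \<times> N)"
proof -
  obtain N' where N': "N' \<in> null_sets lborel" "N \<subseteq> N'"
    using assms by (auto simp: negligible_iff_null_sets null_sets_completion_iff2)
  have "N' \<times> (UNIV :: 'b set) \<in> null_sets (lborel \<Otimes>\<^sub>M lborel)"
    "(UNIV :: 'b set) \<times> N' \<in> null_sets (lborel \<Otimes>\<^sub>M lborel)"
    by (rule lborel.times_in_null_sets1 lborel.times_in_null_sets2; simp add: N'(1))+
  then have "N' \<times> (UNIV :: 'b set) \<in> null_sets lborel" "(UNIV :: 'b set) \<times> N' \<in> null_sets lborel"
    by (simp_all only: lborel_prod)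
  then show "negligible (N \<times> (UNIV :: 'b set))" "negligible ((UNIV :: 'b set) \<times> N)"
    using N'(2) unfolding negligible_iff_null_sets null_sets_completion_iff2
    by (meson Sigma_mono order_refl)+
qed

lemma nonsingular_fst: "nonsingular (fst :: 'a::euclidean_space \<times> 'b::euclidean_space \<Rightarrow> 'a)"
  by (auto simp: nonsingular_def vimage_fst negligible_Times_UNIV
      intro!: borel_measurable_continuous_onI continuous_on_fst)

lemma nonsingular_snd: "nonsingular (snd :: 'a::euclidean_space \<times> 'b::euclidean_space \<Rightarrow> 'b)"
  by (auto simp: nonsingular_def vimage_snd negligible_Times_UNIV
      intro!: borel_measurable_continuous_onI continuous_on_snd)

text \<open>Tuples nest to the right, so this map is not a composition of \<open>fst\<close> and
  \<open>snd\<close>. The preimage of \<open>N\<close> is the image of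
  \<open>N \<times> UNIV\<close> under the linear reassociation of coordinates, and a linear map
  between spaces of equal dimension keeps null sets null.\<close>

lemma nonsingular_first_two:
  "nonsingular (\<lambda>q :: 'a::euclidean_space \<times> 'b::euclidean_space \<times> 'c::euclidean_space.
     (fst q, fst (snd q)))"
  unfolding nonsingular_def
proof (intro conjI allI impI)
  fix N :: "('a \<times> 'b) set"
  let ?assoc = "\<lambda>p :: ('a \<times> 'b) \<times> 'c. (fst (fst p), (snd (fst p), snd p))"
  assume "negligible N"
  moreover have "linear ?assoc"
    by (rule linearI) auto
  ultimately have "negligible (?assoc ` (N \<times> UNIV))"
    by (intro negligible_differentiable_image_negligible negligible_Times_UNIV
        linear_imp_differentiable_on) simp_all
  moreover have "(\<lambda>q. (fst q, fst (snd q))) -` N = ?assoc ` (N \<times> UNIV)"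
    by (force simp: image_iff)
  ultimately show "negligible ((\<lambda>q :: 'a \<times> 'b \<times> 'c. (fst q, fst (snd q))) -` N)"
    by simp
qed (intro borel_measurable_continuous_onI continuous_intros)

text \<open>A Lebesgue set is a Borel set up to a subset of a Borel null set. Borel measurability
  handles the first part, the pullback of null sets the second.\<close>

lemma nonsingular_measurable_lebesgue:
  assumes "nonsingular f"
  shows "f \<in> lebesgue \<rightarrow>\<^sub>M lebesgue"
proof (rule completion.measurable_completion2)
  show f: "f \<in> lebesgue \<rightarrow>\<^sub>M lborel"
    using assms by (simp add: nonsingular_def measurable_completion)
  show "null_sets lborel \<subseteq> null_sets (distr lebesgue lborel f)"
  proof
    fix N :: "'b set"
    assume N: "N \<in> null_sets lborel"
    then have "f -` N \<in> null_sets lebesgue"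
      using assms by (simp add: nonsingular_def negligible_iff_null_sets null_sets_completionI)
    with f N show "N \<in> null_sets (distr lebesgue lborel f)"
      by (auto simp: null_sets_def emeasure_distr)
  qed
qed

lemma nonsingular_measurable_lebesgue_on:
  assumes "nonsingular f" "f \<in> S \<rightarrow> T"
  shows "f \<in> lebesgue_on S \<rightarrow>\<^sub>M lebesgue_on T"
  using assms by (intro measurable_restrict_space3 nonsingular_measurable_lebesgue)

lemma nonsingular_AE_lebesgue_on:
  assumes f: "nonsingular f" "f \<in> S \<rightarrow> T" and [measurable]: "S \<in> sets lebesgue" "T \<in> sets lebesgue"
    and P: "AE y in lebesgue_on T. P y"
  shows "AE x in lebesgue_on S. P (f x)"
proof -
  have "AE y in lebesgue. y \<in> T \<longrightarrow> P y"
    using P by (simp add: AE_restrict_space_iff)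
  \<comment> \<open>By completeness of \<open>lebesgue\<close> the exceptional set itself is null,
    although \<open>P\<close> need not be measurable.\<close>
  then have "negligible {y. \<not> (y \<in> T \<longrightarrow> P y)}"
    by (simp add: negligible_iff_null_sets completion.AE_iff_null_sets)
  then have "negligible (f -` {y. \<not> (y \<in> T \<longrightarrow> P y)})"
    using f(1) unfolding nonsingular_def by blast
  then have "AE x in lebesgue. \<not> x \<in> f -` {y. \<not> (y \<in> T \<longrightarrow> P y)}"
    by (intro AE_not_in) (simp add: negligible_iff_null_sets)
  then show ?thesis
    using f(2) by (auto simp: AE_restrict_space_iff elim!: eventually_mono)
qed

subsection \<open>The unit cube and its projections\<close>

lemma unit_square_lmeasurable: "unit_square \<in> lmeasurable"
  using lmeasurable_cbox[of "(0,0)" "(1,1) :: real \<times> real"] by (simp add: cbox_Pair_eq)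

lemma unit_cube4_lmeasurable: "unit_cube4 \<in> lmeasurable"
  using lmeasurable_cbox[of "(0,0,0,0)" "(1,1,1,1) :: real \<times> real \<times> real \<times> real"]
  by (simp add: cbox_Pair_eq)

lemma nonsingular_pair_projections:
  "nonsingular (\<lambda>q :: real \<times> real \<times> real \<times> real. (fst q, fst (snd q)))"
  "nonsingular (\<lambda>q :: real \<times> real \<times> real \<times> real. snd (snd q))"
  using nonsingular_first_two nonsingular_comp[OF nonsingular_snd nonsingular_snd]
  by (auto simp: comp_def)

lemma nonsingular_coordinates:
  "nonsingular (\<lambda>q :: real \<times> real \<times> real \<times> real. fst q)"
  "nonsingular (\<lambda>q :: real \<times> real \<times> real \<times> real. fst (snd q))"
  "nonsingular (\<lambda>q :: real \<times> real \<times> real \<times> real. fst (snd (snd q)))"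
  "nonsingular (\<lambda>q :: real \<times> real \<times> real \<times> real. snd (snd (snd q)))"
  using nonsingular_fst nonsingular_comp[OF nonsingular_snd nonsingular_fst]
    nonsingular_comp[OF nonsingular_pair_projections(2) nonsingular_fst]
    nonsingular_comp[OF nonsingular_pair_projections(2) nonsingular_snd]
  by (auto simp: comp_def)

text \<open>The weight multiplying the kernel in both densities, written with projections so that
  each factor is \<open>W\<close> composed with a nonsingular map.\<close>

definition graphon_square :: "(real \<times> real \<Rightarrow> real) \<Rightarrow> real \<times> real \<times> real \<times> real \<Rightarrow> real" where
  "graphon_square W q = W (fst q, fst (snd q)) * W (snd (snd q))"

lemma graphon_square_measurable:
  assumes "graphon W"
  shows "graphon_square W \<in> borel_measurable (lebesgue_on unit_cube4)"
proof -
  have W: "W \<in> borel_measurable (lebesgue_on unit_square)"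
    using assms by (simp add: graphon_def)
  have "(\<lambda>q. W (fst q, fst (snd q))) \<in> borel_measurable (lebesgue_on unit_cube4)"
    by (rule measurable_compose[OF nonsingular_measurable_lebesgue_on W])
      (auto intro: nonsingular_pair_projections)
  moreover have "(\<lambda>q. W (snd (snd q))) \<in> borel_measurable (lebesgue_on unit_cube4)"
    by (rule measurable_compose[OF nonsingular_measurable_lebesgue_on W])
      (auto intro: nonsingular_pair_projections)
  ultimately show ?thesis
    unfolding graphon_square_def[abs_def] by (rule borel_measurable_times)
qed

lemma graphon_square_bounds:
  assumes "graphon W" "q \<in> unit_cube4"
  shows "0 \<le> graphon_square W q" "graphon_square W q \<le> 1"
  using assms by (auto simp: graphon_def graphon_square_def intro!: mult_le_one)

lemma abs_graphon_square_diff_le_one: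
  assumes "graphon V" "graphon W" "q \<in> unit_cube4"
  shows "\<bar>graphon_square V q - graphon_square W q\<bar> \<le> 1"
  using graphon_square_bounds[OF assms(1,3)] graphon_square_bounds[OF assms(2,3)] by linarith

lemma integrable_unit_cube4_bounded:
  fixes f :: "real \<times> real \<times> real \<times> real \<Rightarrow> real"
  assumes "f \<in> borel_measurable (lebesgue_on unit_cube4)" "\<And>q. q \<in> unit_cube4 \<Longrightarrow> \<bar>f q\<bar> \<le> B"
  shows "integrable (lebesgue_on unit_cube4) f"
proof -
  interpret finite_measure "lebesgue_on unit_cube4"
    by (rule finite_measure_lebesgue_on[OF unit_cube4_lmeasurable])
  show ?thesis
    using assms by (intro integrable_const_bound[of _ B] AE_I2) auto
qed

subsection \<open>Infima over families of kernels\<close>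

lemma abs_cINF_diff_le:
  fixes f g :: "'i \<Rightarrow> real"
  assumes "\<And>i. i \<in> A \<Longrightarrow> \<bar>f i - g i\<bar> \<le> e" "bdd_below (f ` A)" "bdd_below (g ` A)" "0 \<le> e"
  shows "\<bar>(INF i\<in>A. f i) - (INF i\<in>A. g i)\<bar> \<le> e"
\<comment> \<open>For empty \<open>A\<close> both infima are the same default value, so their
  difference is 0 and \<open>0 \<le> e\<close> suffices. Hence neither family of drawings has to be
  shown nonempty.\<close>
proof (cases "A = {}")
  case False
  have "(INF i\<in>A. f i) - e \<le> (INF i\<in>A. g i)"
  proof (rule cINF_greatest[OF False])
    fix i assume "i \<in> A"
    with assms(1)[of i] cINF_lower[OF assms(2), of i] show "(INF i\<in>A. f i) - e \<le> g i" by auto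
  qed
  moreover have "(INF i\<in>A. g i) - e \<le> (INF i\<in>A. f i)"
  proof (rule cINF_greatest[OF False])
    fix i assume "i \<in> A"
    with assms(1)[of i] cINF_lower[OF assms(3), of i] show "(INF i\<in>A. g i) - e \<le> f i" by auto
  qed
  ultimately show ?thesis by auto
qed (simp add: assms)

text \<open>Captures what \<open>segments_meet\<close> and \<open>curves_meet\<close> share, so that
  the limit argument is made once. The bounds range over all \<open>i\<close> and \<open>q\<close>
  because both kernels take only the values 0 and 1.\<close>

locale kernel_family =
  fixes A :: "'i set" and k :: "'i \<Rightarrow> real \<times> real \<times> real \<times> real \<Rightarrow> real"
  assumes kernel_measurable: "i \<in> A \<Longrightarrow> k i \<in> borel_measurable (lebesgue_on unit_cube4)"
    and kernel_nonneg: "0 \<le> k i q"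
    and kernel_le_one: "k i q \<le> 1"
begin

definition density_of :: "(real \<times> real \<Rightarrow> real) \<Rightarrow> 'i \<Rightarrow> real" where
  "density_of W i = 1 / 8 * integral\<^sup>L (lebesgue_on unit_cube4) (\<lambda>q. graphon_square W q * k i q)"

lemma bdd_below_density_of:
  assumes "graphon W"
  shows "bdd_below (density_of W ` A)"
proof (rule bdd_belowI2)
  show "0 \<le> density_of W i" for i
    unfolding density_of_def
    by (intro mult_nonneg_nonneg integral_nonneg_AE AE_I2)
      (use graphon_square_bounds[OF assms] kernel_nonneg in auto)
qed

lemma abs_density_of_diff_le:
  assumes V: "graphon V" and W: "graphon W" and i: "i \<in> A"
  shows "\<bar>density_of V i - density_of W i\<bar> \<le>
    1 / 8 * integral\<^sup>L (lebesgue_on unit_cube4) (\<lambda>q. \<bar>graphon_square V q - graphon_square W q\<bar>)"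
proof -
  let ?M = "lebesgue_on unit_cube4"
  note [measurable] = graphon_square_measurable[OF V] graphon_square_measurable[OF W]
    kernel_measurable[OF i]
  have int: "integrable ?M (\<lambda>q. graphon_square U q * k i q)" if "graphon U" for U
    using graphon_square_bounds[OF that] kernel_nonneg kernel_le_one
      graphon_square_measurable[OF that] kernel_measurable[OF i]
    by (intro integrable_unit_cube4_bounded[where B = 1]) (auto simp: abs_mult intro!: mult_le_one)
  have "\<bar>integral\<^sup>L ?M (\<lambda>q. graphon_square V q * k i q) -
      integral\<^sup>L ?M (\<lambda>q. graphon_square W q * k i q)\<bar>
      = \<bar>integral\<^sup>L ?M (\<lambda>q. graphon_square V q * k i q - graphon_square W q * k i q)\<bar>"
    by (simp add: int V W)
  also have "\<dots> \<le> integral\<^sup>L ?M (\<lambda>q. \<bar>graphon_square V q * k i q - graphon_square W q * k i q\<bar>)"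
    by (rule integral_abs_bound)
  \<comment> \<open>The kernel factors out of the difference and lies between 0 and 1; discarding it
    makes the bound uniform in \<open>i\<close>.\<close>
  also have "\<dots> \<le> integral\<^sup>L ?M (\<lambda>q. \<bar>graphon_square V q - graphon_square W q\<bar>)"
  proof (rule integral_mono)
    show "integrable ?M (\<lambda>q. \<bar>graphon_square V q - graphon_square W q\<bar>)"
      using abs_graphon_square_diff_le_one[OF V W]
      by (intro integrable_unit_cube4_bounded[where B = 1]) auto
    show "\<bar>graphon_square V q * k i q - graphon_square W q * k i q\<bar>
        \<le> \<bar>graphon_square V q - graphon_square W q\<bar>" for q
      using kernel_nonneg[of i q] kernel_le_one[of i q]
      by (simp add: left_diff_distrib[symmetric] abs_mult mult_left_le)
  qed (intro integrable_abs Bochner_Integration.integrable_diff int V W)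
  finally show ?thesis
    unfolding density_of_def by linarith
qed

lemma tendsto_INF_density_of:
  assumes Ws: "\<And>n. graphon (Ws n)" and W: "graphon W"
    and lim: "AE p in lebesgue_on unit_square. (\<lambda>n. Ws n p) \<longlonglongrightarrow> W p"
  shows "(\<lambda>n. INF i\<in>A. density_of (Ws n) i) \<longlonglongrightarrow> (INF i\<in>A. density_of W i)"
proof (rule LIM_zero_cancel, rule Lim_null_comparison, rule always_eventually, rule allI)
  let ?M = "lebesgue_on unit_cube4"
  let ?e = "\<lambda>n. integral\<^sup>L ?M (\<lambda>q. \<bar>graphon_square (Ws n) q - graphon_square W q\<bar>)"
  show "norm ((INF i\<in>A. density_of (Ws n) i) - (INF i\<in>A. density_of W i)) \<le> 1 / 8 * ?e n" for n
    unfolding real_norm_def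
    by (intro abs_cINF_diff_le abs_density_of_diff_le bdd_below_density_of Ws W) auto
  have [measurable]: "graphon_square (Ws n) \<in> borel_measurable ?M" for n
    by (rule graphon_square_measurable[OF Ws])
  note [measurable] = graphon_square_measurable[OF W]
  \<comment> \<open>The null set of the square where convergence fails pulls back to a null set of
    the cube, once for each pair of coordinates.\<close>
  have AE12: "AE q in ?M. (\<lambda>n. Ws n (fst q, fst (snd q))) \<longlonglongrightarrow> W (fst q, fst (snd q))"
    by (rule nonsingular_AE_lebesgue_on[OF nonsingular_pair_projections(1) _ _ _ lim])
      (auto intro: unit_square_lmeasurable unit_cube4_lmeasurable fmeasurableD)
  have AE34: "AE q in ?M. (\<lambda>n. Ws n (snd (snd q))) \<longlonglongrightarrow> W (snd (snd q))"
    by (rule nonsingular_AE_lebesgue_on[OF nonsingular_pair_projections(2) _ _ _ lim])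
      (auto intro: unit_square_lmeasurable unit_cube4_lmeasurable fmeasurableD)
  have "?e \<longlonglongrightarrow> integral\<^sup>L ?M (\<lambda>q. 0)"
  \<comment> \<open>The products have values in [0,1], so the constant 1 dominates; it is integrable
    because the cube has finite measure.\<close>
  proof (rule integral_dominated_convergence[where w = "\<lambda>q. 1"])
    show "AE q in ?M. (\<lambda>n. \<bar>graphon_square (Ws n) q - graphon_square W q\<bar>) \<longlonglongrightarrow> 0"
      using AE12 AE34
    proof eventually_elim
      case (elim q)
      then have "(\<lambda>n. graphon_square (Ws n) q) \<longlonglongrightarrow> graphon_square W q"
        unfolding graphon_square_def by (rule tendsto_mult)
      then show ?case
        by (intro tendsto_rabs_zero LIM_zero)
    qed
    show "AE q in ?M. norm \<bar>graphon_square (Ws n) q - graphon_square W q\<bar> \<le> 1" for n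
      using abs_graphon_square_diff_le_one[OF Ws W] by (intro AE_I2) simp
    show "integrable ?M (\<lambda>q. 1 :: real)"
      by (rule integrable_unit_cube4_bounded[where B = 1]) auto
  qed simp_all
  then show "(\<lambda>n. 1 / 8 * ?e n) \<longlonglongrightarrow> 0"
    by (auto intro: tendsto_mult_right_zero)
qed

end

subsection \<open>The two kernel families\<close>

text \<open>Both segment parameters are packed into one point \<open>s\<close> of a compact square,
  the form needed for projecting along a compact factor.\<close>

lemma convex_hull_pair_meet_iff:
  "convex hull {x, y} \<inter> convex hull {z, w :: 'a::real_vector} \<noteq> {} \<longleftrightarrow>
    (\<exists>s\<in>{0..1} \<times> {0..1}. (1 - fst s) *\<^sub>R x + fst s *\<^sub>R y = (1 - snd s) *\<^sub>R z + snd s *\<^sub>R w)"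
proof -
  have "(\<exists>p. p \<in> closed_segment x y \<and> p \<in> closed_segment z w) \<longleftrightarrow>
      (\<exists>s\<in>{0..1}. \<exists>t\<in>{0..1}. (1 - s) *\<^sub>R x + s *\<^sub>R y = (1 - t) *\<^sub>R z + t *\<^sub>R w)"
    unfolding closed_segment_def mem_Collect_eq Bex_def atLeastAtMost_iff by metis
  then show ?thesis
    unfolding segment_convex_hull[symmetric] disjoint_iff Bex_def by auto
qed

text \<open>The equation between the two parametrized points is a closed condition on parameters and
  endpoints jointly, and projecting away a compact factor preserves closedness.\<close>

lemma closed_meeting_segments:
  "closed {(x, y, z, w :: 'a::euclidean_space). convex hull {x, y} \<inter> convex hull {z, w} \<noteq> {}}"
proof -
  let ?T = "{(s :: real \<times> real, x, y, z, w :: 'a).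
      (1 - fst s) *\<^sub>R x + fst s *\<^sub>R y = (1 - snd s) *\<^sub>R z + snd s *\<^sub>R w}"
  have "closed ?T"
    unfolding case_prod_unfold by (intro closed_Collect_eq continuous_intros)
  moreover have "compact ({0..1} \<times> {0..1} :: (real \<times> real) set)"
    by (intro compact_Times) auto
  ultimately have "closed {v. \<exists>s. s \<in> {0..1} \<times> {0..1} \<and> (s, v) \<in> ?T}"
    by (intro closed_compact_projection)
  also have "{v. \<exists>s. s \<in> {0..1} \<times> {0..1} \<and> (s, v) \<in> ?T} =
      {(x, y, z, w). convex hull {x, y} \<inter> convex hull {z, w} \<noteq> {}}"
    unfolding convex_hull_pair_meet_iff Bex_def by (simp add: case_prod_unfold)
  finally show ?thesis .
qed

text \<open>Borel measurability matters here: it allows composition with a placement that is only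
  Lebesgue measurable.\<close>

lemma segments_meet_measurable:
  "(\<lambda>(x, y, z, w). segments_meet x y z w) \<in> borel_measurable borel"
proof -
  have "(\<lambda>(x, y, z, w). segments_meet x y z w) =
      indicator {(x, y, z, w). convex hull {x, y} \<inter> convex hull {z, w} \<noteq> {}}"
    by (auto simp: segments_meet_def fun_eq_iff)
  then show ?thesis
    using borel_measurable_indicator[OF borel_closed[OF closed_meeting_segments]] by metis
qed

lemma placement_kernel_measurable:
  assumes "f \<in> placements"
  shows "(\<lambda>(x1, x2, x3, x4). segments_meet (f x1) (f x2) (f x3) (f x4))
    \<in> borel_measurable (lebesgue_on unit_cube4)"
proof -
  have f: "f \<in> borel_measurable (lebesgue_on {0..1})"
    using assms by (simp add: placements_def)
  have [measurable]: "(\<lambda>q. f (fst q)) \<in> borel_measurable (lebesgue_on unit_cube4)"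
      "(\<lambda>q. f (fst (snd q))) \<in> borel_measurable (lebesgue_on unit_cube4)"
      "(\<lambda>q. f (fst (snd (snd q)))) \<in> borel_measurable (lebesgue_on unit_cube4)"
      "(\<lambda>q. f (snd (snd (snd q)))) \<in> borel_measurable (lebesgue_on unit_cube4)"
    by (rule measurable_compose[OF nonsingular_measurable_lebesgue_on f];
        auto intro: nonsingular_coordinates)+
  have "(\<lambda>q. (f (fst q), f (fst (snd q)), f (fst (snd (snd q))), f (snd (snd (snd q)))))
      \<in> borel_measurable (lebesgue_on unit_cube4)"
    by (intro borel_measurable_Pair) measurable
  from measurable_compose[OF this segments_meet_measurable] show ?thesis
    by (simp add: case_prod_unfold)
qed

theorem theorem11:
  fixes W :: "real \<times> real \<Rightarrow> real" and Ws :: "nat \<Rightarrow> real \<times> real \<Rightarrow> real"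
  assumes "\<And>n. graphon (Ws n)"
    and "graphon W"
    and "AE p in lebesgue_on unit_square. (\<lambda>n. Ws n p) \<longlonglongrightarrow> W p"
  shows "(\<lambda>n. rect_crossing_density (Ws n)) \<longlonglongrightarrow> rect_crossing_density W
       \<and> (\<lambda>n. crossing_density (Ws n)) \<longlonglongrightarrow> crossing_density W"
proof
  interpret rect: kernel_family placements
    "\<lambda>f (x1, x2, x3, x4). segments_meet (f x1) (f x2) (f x3) (f x4)"
    by unfold_locales (rule placement_kernel_measurable, auto simp: segments_meet_def)
  have "rect_crossing_density V = (INF f\<in>placements. rect.density_of V f)" for V
    unfolding rect_crossing_density_def rect_crossing_density_of_def rect.density_of_def
      graphon_square_def by (simp add: case_prod_unfold)
  then show "(\<lambda>n. rect_crossing_density (Ws n)) \<longlonglongrightarrow> rect_crossing_density W"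
    using rect.tendsto_INF_density_of[OF assms] by simp
  \<comment> \<open>Unlike for placements, measurability of the kernel is part of the definition of
    \<open>measurable_drawings\<close>.\<close>
  interpret curve: kernel_family measurable_drawings
    "\<lambda>D (x1, x2, x3, x4). curves_meet D x1 x2 x3 x4"
    by unfold_locales (auto simp: measurable_drawings_def curves_meet_def)
  have "crossing_density V = (INF D\<in>measurable_drawings. curve.density_of V D)" for V
    unfolding crossing_density_def crossing_density_of_def curve.density_of_def
      graphon_square_def by (simp add: case_prod_unfold)
  then show "(\<lambda>n. crossing_density (Ws n)) \<longlonglongrightarrow> crossing_density W"
    using curve.tendsto_INF_density_of[OF assms] by simp
qed

end
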